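(* Let $f_j\in L^2(0,T;H^{-1}(D))$ for $j=1,\dots,J$, and suppose that the following two conditions hold. (i) There is a constant $\theta>0$ such that for every $t\in[0,T]$ and every $j=1,\dots,J$, $\min_{\mathbf x\in\overline D}a_j(\mathbf x,t)\ge\theta$. (ii) There are constants $\theta_->0$ and $\theta_+>0$ such that for every $t\in[0,T]$ and every $j=1,\dots,J$, $\theta_-\le|a_j(\cdot,t)-\overline a(\cdot,t)|_\infty\le\theta_+$. Then the fully discrete ensemble scheme described in the context is stable provided that $\theta>\theta_+$. Furthermore, in that case its solution satisfies, for every $j=1,\dots,J$, $$\|u_{j,h}^N\|^2+\theta_-\Delta t\,\|\nabla u_{j,h}^{N}\|^2+(\theta-\theta_+)\Delta t\sum_{n=1}^{N}\|\nabla u_{j,h}^{n}\|^2\le C\Delta t\sum_{n=1}^{N}\|f_j^{n}\|_{-1}^2+C\Delta t\,\|\nabla u_{j,h}^0\|^2+\|u_{j,h}^0\|^2,$$ where $C>0$ is a constant independent of $J$, $h$ and $\Delta t$.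
   Context: $D\subset\mathbb R^d$ ($d=1,2,3$) is a bounded Lipschitz domain, $T>0$, $l\ge1$ an integer, $J\ge1$ an integer. $\|\cdot\|$ and $(\cdot,\cdot)$ are the $L^2(D)$ norm and inner product (also used for the duality pairing of $H^{-1}(D)$ and $H_0^1(D)$), $|v|_\infty=\operatorname{ess\,sup}_{\mathbf x\in D}|v(\mathbf x)|$, and $\|f\|_{-1}=\sup_{0\ne v\in H_0^1(D)}(f,v)/\|\nabla v\|$. For $j=1,\dots,J$ consider the problems $u_{j,t}-\nabla\cdot[a_j(\mathbf x,t)\nabla u_j]=f_j(\mathbf x,t)$ in $D\times(0,T)$, $u_j=0$ on $\partial D\times(0,T)$, $u_j(\cdot,0)=u_j^0$ in $D$, with $a_j\in L^2(0,T;W^{1,\infty}(D))$ and $u_j^0\in H_0^1(D)\cap H^{l+1}(D)$. The ensemble mean is $\overline a(\mathbf x,t)=\frac1J\sum_{j=1}^Ja_j(\mathbf x,t)$. $\mathcal T_h$ is a quasi-uniform triangulation of $D$ with mesh size $h=\max_{K\in\mathcal T_h}\operatorname{diam}K$, $\overline D=\bigcup_{K\in\mathcal T_h}\overline K$, and $V_h=\{v\in H_0^1(D): v|_K\text{ is a polynomial of degree at most } l\text{ for all }K\in\mathcal T_h\}$. Let $\Delta t=T/N$ with $N\ge1$ an integer, and $t_n=n\Delta t$; a superscript $n$ on $a_j,\overline a,f_j$ denotes evaluation at $t=t_n$ (the data are assumed to be such that these evaluations make sense, with $a_j^n\in L^\infty(D)$ and $f_j^n\in H^{-1}(D)$). Fully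 discrete ensemble scheme: $u_{j,h}^0\in V_h$ satisfies $(u_{j,h}^0,v_h)=(u_j^0,v_h)$ for all $v_h\in V_h$, and for $n=0,\dots,N-1$ and $j=1,\dots,J$, $u_{j,h}^{n+1}\in V_h$ satisfies $$\Big(\frac{u_{j,h}^{n+1}-u_{j,h}^n}{\Delta t},v_h\Big)+(\overline a^{n+1}\nabla u_{j,h}^{n+1},\nabla v_h)+((a_j^{n+1}-\overline a^{n+1})\nabla u_{j,h}^n,\nabla v_h)=(f_j^{n+1},v_h)\quad\forall v_h\in V_h.$$ The constant $C$ is generic; it may depend on $\theta,\theta_-,\theta_+$. "Stable" means that the displayed bound by the data holds. *)

theory Defs
  imports "HOL-Analysis.Analysis" "HOL-Probability.Essential_Supremum"
begin

text \<open>
  Elements of Lebesgue and Sobolev spaces on \<open>D\<close> are represented by functions on the whole type;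
  the spaces, norms and inner products depend only on their values on \<open>D\<close>, up to null sets.
\<close>

section \<open>Lipschitz domains\<close>

text \<open>
  Near each boundary point \<open>D\<close> is the epigraph of a Lipschitz function \<open>\<gamma>\<close>, defined on the hyperplane
  orthogonal to a unit vector \<open>e\<close>; \<open>y - (y \<bullet> e) *\<^sub>R e\<close> is the projection onto that hyperplane.
\<close>

definition lipschitz_domain :: "'a::euclidean_space set \<Rightarrow> bool" where
  "lipschitz_domain D \<longleftrightarrow>
     open D \<and> connected D \<and> D \<noteq> {} \<and>
     (\<forall>z\<in>frontier D. \<exists>r>0. \<exists>e. \<exists>L. \<exists>\<gamma> :: 'a \<Rightarrow> real.
        norm e = 1 \<and> L-lipschitz_on {y. y \<bullet> e = 0} \<gamma> \<and>
        D \<inter> ball z r = {y \<in> ball z r. \<gamma> (y - (y \<bullet> e) *\<^sub>R e) < y \<bullet> e})"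

section \<open>Lebesgue spaces\<close>

definition L2 :: "'a::euclidean_space set \<Rightarrow> ('a \<Rightarrow> 'b::euclidean_space) set" where
  "L2 D = {v \<in> borel_measurable (lebesgue_on D). integrable (lebesgue_on D) (\<lambda>x. (norm (v x))\<^sup>2)}"

definition L2_inner :: "'a::euclidean_space set \<Rightarrow> ('a \<Rightarrow> 'b::euclidean_space) \<Rightarrow> ('a \<Rightarrow> 'b) \<Rightarrow> real" where
  "L2_inner D v w = (LINT x|lebesgue_on D. v x \<bullet> w x)"

definition L2_norm :: "'a::euclidean_space set \<Rightarrow> ('a \<Rightarrow> 'b::euclidean_space) \<Rightarrow> real" where
  "L2_norm D v = sqrt (L2_inner D v v)"

definition Linf_norm :: "'a::euclidean_space set \<Rightarrow> ('a \<Rightarrow> 'b::euclidean_space) \<Rightarrow> ereal" where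
  "Linf_norm D v = esssup (lebesgue_on D) (\<lambda>x. ereal (norm (v x)))"

definition Linf :: "'a::euclidean_space set \<Rightarrow> ('a \<Rightarrow> 'b::euclidean_space) set" where
  "Linf D = {v \<in> borel_measurable (lebesgue_on D). Linf_norm D v < \<infinity>}"

section \<open>Weak derivatives and Sobolev spaces\<close>

primrec continuously_differentiable :: "nat \<Rightarrow> ('a::euclidean_space \<Rightarrow> real) \<Rightarrow> bool" where
  "continuously_differentiable 0 \<phi> \<longleftrightarrow> continuous_on UNIV \<phi>"
| "continuously_differentiable (Suc k) \<phi> \<longleftrightarrow>
     (\<exists>g. (\<forall>x. (\<phi> has_derivative (\<lambda>h. g x \<bullet> h)) (at x)) \<and>
          (\<forall>b\<in>Basis. continuously_differentiable k (\<lambda>x. g x \<bullet> b)))"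

definition test_function :: "'a::euclidean_space set \<Rightarrow> ('a \<Rightarrow> real) \<Rightarrow> bool" where
  "test_function D \<phi> \<longleftrightarrow>
     (\<forall>k. continuously_differentiable k \<phi>) \<and>
     compact (closure {x. \<phi> x \<noteq> 0}) \<and> closure {x. \<phi> x \<noteq> 0} \<subseteq> D"

definition locally_integrable :: "'a::euclidean_space set \<Rightarrow> ('a \<Rightarrow> 'b::euclidean_space) \<Rightarrow> bool" where
  "locally_integrable D v \<longleftrightarrow> (\<forall>K. compact K \<and> K \<subseteq> D \<longrightarrow> integrable (lebesgue_on K) v)"

definition has_weak_gradient :: "'a::euclidean_space set \<Rightarrow> ('a \<Rightarrow> real) \<Rightarrow> ('a \<Rightarrow> 'a) \<Rightarrow> bool" where
  "has_weak_gradient D v g \<longleftrightarrow>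
     locally_integrable D v \<and> locally_integrable D g \<and>
     (\<forall>\<phi>. test_function D \<phi> \<longrightarrow>
        (\<forall>b\<in>Basis. (LINT x|lebesgue_on D. v x * frechet_derivative \<phi> (at x) b) =
                  - (LINT x|lebesgue_on D. (g x \<bullet> b) * \<phi> x)))"

definition weakly_differentiable :: "'a::euclidean_space set \<Rightarrow> ('a \<Rightarrow> real) \<Rightarrow> bool" where
  "weakly_differentiable D v \<longleftrightarrow> (\<exists>g. has_weak_gradient D v g)"

text \<open>The weak gradient is unique up to null sets; \<open>wgrad\<close> picks a representative.\<close>

definition wgrad :: "'a::euclidean_space set \<Rightarrow> ('a \<Rightarrow> real) \<Rightarrow> 'a \<Rightarrow> 'a" where
  "wgrad D v = (SOME g. has_weak_gradient D v g)"

primrec sobolev_H :: "nat \<Rightarrow> 'a::euclidean_space set \<Rightarrow> ('a \<Rightarrow> real) set" where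
  "sobolev_H 0 D = L2 D"
| "sobolev_H (Suc k) D =
     {v \<in> L2 D. weakly_differentiable D v \<and> (\<forall>b\<in>Basis. (\<lambda>x. wgrad D v x \<bullet> b) \<in> sobolev_H k D)}"

definition H1_norm :: "'a::euclidean_space set \<Rightarrow> ('a \<Rightarrow> real) \<Rightarrow> real" where
  "H1_norm D v = sqrt ((L2_norm D v)\<^sup>2 + (L2_norm D (wgrad D v))\<^sup>2)"

definition H10 :: "'a::euclidean_space set \<Rightarrow> ('a \<Rightarrow> real) set" where
  "H10 D = {v \<in> sobolev_H 1 D.
     \<exists>\<phi>. (\<forall>k. test_function D (\<phi> k)) \<and> (\<lambda>k. H1_norm D (\<lambda>x. v x - \<phi> k x)) \<longlonglongrightarrow> 0}"

definition W1inf :: "'a::euclidean_space set \<Rightarrow> ('a \<Rightarrow> real) set" where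
  "W1inf D = {v \<in> Linf D. weakly_differentiable D v \<and> wgrad D v \<in> Linf D}"

definition W1inf_norm :: "'a::euclidean_space set \<Rightarrow> ('a \<Rightarrow> real) \<Rightarrow> real" where
  "W1inf_norm D v = real_of_ereal (Linf_norm D v) + real_of_ereal (Linf_norm D (wgrad D v))"

text \<open>
  \<open>Hm1 D\<close> is the dual space of \<open>H10 D\<close>, the latter normed by \<open>\<parallel>\<nabla>v\<parallel>\<close>. A functional is a total function
  of which only the values on \<open>H10 D\<close> matter, and \<open>F v\<close> is the duality pairing \<open>(F, v)\<close>.
  The bound also makes \<open>F\<close> compatible with equality almost everywhere.
\<close>

definition Hm1 :: "'a::euclidean_space set \<Rightarrow> (('a \<Rightarrow> real) \<Rightarrow> real) set" where
  "Hm1 D = {F.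
     (\<forall>v\<in>H10 D. \<forall>w\<in>H10 D. F (\<lambda>x. v x + w x) = F v + F w) \<and>
     (\<forall>c. \<forall>v\<in>H10 D. F (\<lambda>x. c * v x) = c * F v) \<and>
     (\<exists>B. \<forall>v\<in>H10 D. \<bar>F v\<bar> \<le> B * L2_norm D (wgrad D v))}"

definition Hm1_norm :: "'a::euclidean_space set \<Rightarrow> (('a \<Rightarrow> real) \<Rightarrow> real) \<Rightarrow> real" where
  "Hm1_norm D F =
     (SUP v\<in>{v \<in> H10 D. \<not> (AE x in lebesgue_on D. v x = 0)}. F v / L2_norm D (wgrad D v))"

text \<open>
  The Bochner space \<open>L\<^sup>2(0,T;X)\<close> for a space \<open>X\<close> of functions with norm \<open>nrm\<close>: \<open>g\<close> is strongly measurable,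
  i.e. almost everywhere the limit in \<open>X\<close> of simple functions, and its norm is square integrable.
\<close>

definition bochner_L2 :: "real \<Rightarrow> ('c \<Rightarrow> real) set \<Rightarrow> (('c \<Rightarrow> real) \<Rightarrow> real) \<Rightarrow> (real \<Rightarrow> 'c \<Rightarrow> real) set" where
  "bochner_L2 T X nrm = {g.
     (AE t in lebesgue_on {0<..<T}. g t \<in> X) \<and>
     (\<exists>s. (\<forall>k. simple_function (lebesgue_on {0<..<T}) (s k) \<and> (\<forall>t\<in>{0<..<T}. s k t \<in> X)) \<and>
          (AE t in lebesgue_on {0<..<T}. (\<lambda>k. nrm (\<lambda>x. g t x - s k t x)) \<longlonglongrightarrow> 0)) \<and>
     (\<integral>\<^sup>+t. ennreal ((nrm (g t))\<^sup>2) \<partial>lebesgue_on {0<..<T}) < \<infinity>}"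

section \<open>Finite elements\<close>

definition mesh_size :: "'a::euclidean_space set set \<Rightarrow> real" where
  "mesh_size \<T> = Max (diameter ` \<T>)"

text \<open>
  The elements are closed simplices. Quasi-uniformity is a property of a family of meshes: each
  element contains a ball of diameter at least \<open>\<rho> * h\<close>, where \<open>\<rho>\<close> is common to the whole family; hence
  \<open>\<rho>\<close> is an explicit parameter here.
\<close>

definition quasi_uniform_triangulation :: "real \<Rightarrow> 'a::euclidean_space set \<Rightarrow> 'a set set \<Rightarrow> bool" where
  "quasi_uniform_triangulation \<rho> D \<T> \<longleftrightarrow>
     triangulation \<T> \<and> (\<forall>K\<in>\<T>. int DIM('a) simplex K) \<and> \<Union>\<T> = closure D \<and>
     (\<forall>K\<in>\<T>. \<exists>z r. ball z r \<subseteq> K \<and> \<rho> * mesh_size \<T> \<le> 2 * r)"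

definition polynomial_of_degree_le :: "nat \<Rightarrow> ('a::euclidean_space \<Rightarrow> real) \<Rightarrow> bool" where
  "polynomial_of_degree_le l p \<longleftrightarrow>
     (\<exists>c :: ('a \<Rightarrow> nat) \<Rightarrow> real. \<forall>x. p x =
        (\<Sum>\<alpha> | \<alpha> \<in> Basis \<rightarrow>\<^sub>E {..l} \<and> (\<Sum>b\<in>Basis. \<alpha> b) \<le> l. c \<alpha> * (\<Prod>b\<in>Basis. (x \<bullet> b) ^ \<alpha> b)))"

definition fe_space :: "'a::euclidean_space set \<Rightarrow> 'a set set \<Rightarrow> nat \<Rightarrow> ('a \<Rightarrow> real) set" where
  "fe_space D \<T> l =
     {v \<in> H10 D. \<forall>K\<in>\<T>. \<exists>p. polynomial_of_degree_le l p \<and> (AE x in lebesgue_on K. v x = p x)}"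

section \<open>The ensemble scheme\<close>

definition ensemble_mean :: "nat \<Rightarrow> (nat \<Rightarrow> real \<Rightarrow> 'a \<Rightarrow> real) \<Rightarrow> real \<Rightarrow> 'a \<Rightarrow> real" where
  "ensemble_mean J a t x = (\<Sum>j=1..J. a j t x) / real J"

text \<open>
  \<open>u j n\<close> is the approximation of the \<open>j\<close>-th ensemble member at time \<open>n * dt\<close>, and \<open>f j t v\<close> is the
  duality pairing of the functional \<open>f j t\<close> with \<open>v\<close>.
\<close>

definition ensemble_scheme ::
  "'a::euclidean_space set \<Rightarrow> ('a \<Rightarrow> real) set \<Rightarrow> real \<Rightarrow> nat \<Rightarrow> nat \<Rightarrow> (nat \<Rightarrow> real \<Rightarrow> 'a \<Rightarrow> real) \<Rightarrow>
   (nat \<Rightarrow> real \<Rightarrow> ('a \<Rightarrow> real) \<Rightarrow> real) \<Rightarrow> (nat \<Rightarrow> 'a \<Rightarrow> real) \<Rightarrow> (nat \<Rightarrow> nat \<Rightarrow> 'a \<Rightarrow> real) \<Rightarrow> bool" where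
  "ensemble_scheme D V dt N J a f u0 u \<longleftrightarrow>
     (\<forall>j\<in>{1..J}.
        (\<forall>n\<in>{0..N}. u j n \<in> V) \<and>
        (\<forall>v\<in>V. L2_inner D (u j 0) v = L2_inner D (u0 j) v) \<and>
        (\<forall>n<N. \<forall>v\<in>V.
           let t = real (Suc n) * dt; am = ensemble_mean J a t in
             L2_inner D (\<lambda>x. (u j (Suc n) x - u j n x) / dt) v
             + L2_inner D (\<lambda>x. am x *\<^sub>R wgrad D (u j (Suc n)) x) (wgrad D v)
             + L2_inner D (\<lambda>x. (a j t x - am x) *\<^sub>R wgrad D (u j n) x) (wgrad D v)
             = f j t v))"

end

theory Submission
  imports Defs
begin

text \<open>
  Testing the scheme with \<open>u\<^sup>n\<^sup>+\<^sup>1\<close> and applying Young's inequality to the lagged term and (with weight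
  \<open>\<theta> - \<theta>p\<close>) to the load gives
  \<open>\<parallel>u\<^sup>n\<^sup>+\<^sup>1\<parallel>\<^sup>2 - \<parallel>u\<^sup>n\<parallel>\<^sup>2 + dt (\<theta> \<parallel>\<nabla>u\<^sup>n\<^sup>+\<^sup>1\<parallel>\<^sup>2 - \<theta>p \<parallel>\<nabla>u\<^sup>n\<parallel>\<^sup>2) \<le> dt \<parallel>f\<^sup>n\<^sup>+\<^sup>1\<parallel>\<^sup>2 / (\<theta> - \<theta>p)\<close>.
  Summation telescopes, and \<open>\<theta>m \<le> \<theta>p\<close>.
\<close>

section \<open>Square integrable functions\<close>

lemma L2_norm_squared: "(L2_norm D v)\<^sup>2 = L2_inner D v v"
  unfolding L2_norm_def L2_inner_def by (simp add: integral_nonneg_AE)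

lemma L2_normsq_eq: "(L2_norm D v)\<^sup>2 = (LINT x|lebesgue_on D. (norm (v x))\<^sup>2)"
  unfolding L2_norm_squared L2_inner_def by (simp add: power2_norm_eq_inner)

lemma abs_inner_le_squares:
  fixes x y :: "'a::real_inner"
  shows "2 * \<bar>x \<bullet> y\<bar> \<le> (norm x)\<^sup>2 + (norm y)\<^sup>2"
proof -
  have "2 * (norm x * norm y) \<le> (norm x)\<^sup>2 + (norm y)\<^sup>2"
    using sum_squares_bound[of "norm x" "norm y"] by simp
  then show ?thesis
    using Cauchy_Schwarz_ineq2[of x y] by simp
qed

text \<open>The pointwise Young inequality makes \<open>B / 2\<close> times the sum of the squared
  norms an integrable majorant, and this one majorant yields both claims. The lagged fluctuation
  term uses it with bound \<open>\<theta>p\<close>, plain L2 products with weight 1.\<close>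

lemma weighted_inner_bound:
  fixes v w :: "'a::euclidean_space \<Rightarrow> 'b::euclidean_space" and c :: "'a \<Rightarrow> real"
  assumes v: "v \<in> L2 D" and w: "w \<in> L2 D"
    and c: "c \<in> borel_measurable (lebesgue_on D)" "AE x in lebesgue_on D. \<bar>c x\<bar> \<le> B"
  shows "integrable (lebesgue_on D) (\<lambda>x. (c x *\<^sub>R v x) \<bullet> w x)" (is ?int)
    and "2 * \<bar>L2_inner D (\<lambda>x. c x *\<^sub>R v x) w\<bar> \<le> B * ((L2_norm D v)\<^sup>2 + (L2_norm D w)\<^sup>2)" (is ?bnd)
proof -
  have mv: "v \<in> borel_measurable (lebesgue_on D)" and mw: "w \<in> borel_measurable (lebesgue_on D)"
    and iv: "integrable (lebesgue_on D) (\<lambda>x. (norm (v x))\<^sup>2)"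
    and iw: "integrable (lebesgue_on D) (\<lambda>x. (norm (w x))\<^sup>2)"
    using v w by (auto simp: L2_def)
  let ?g = "\<lambda>x. B / 2 * ((norm (v x))\<^sup>2 + (norm (w x))\<^sup>2)"
  have ig: "integrable (lebesgue_on D) ?g"
    using iv iw by auto
  have AEb: "AE x in lebesgue_on D. norm ((c x *\<^sub>R v x) \<bullet> w x) \<le> ?g x"
    using c(2)
  proof eventually_elim
    case (elim x)
    have "norm ((c x *\<^sub>R v x) \<bullet> w x) = \<bar>c x\<bar> * \<bar>v x \<bullet> w x\<bar>"
      by (simp add: abs_mult)
    also have "\<dots> \<le> B * (((norm (v x))\<^sup>2 + (norm (w x))\<^sup>2) / 2)"
      using elim abs_inner_le_squares[of "v x" "w x"] by (intro mult_mono) auto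
    finally show ?case by simp
  qed
  show i: ?int
  proof (rule Bochner_Integration.integrable_bound[OF ig])
    show "(\<lambda>x. (c x *\<^sub>R v x) \<bullet> w x) \<in> borel_measurable (lebesgue_on D)"
      using mv mw c(1) by measurable
    show "AE x in lebesgue_on D. norm ((c x *\<^sub>R v x) \<bullet> w x) \<le> norm (?g x)"
      using AEb by eventually_elim (metis abs_ge_self order_trans real_norm_def)
  qed
  have "\<bar>L2_inner D (\<lambda>x. c x *\<^sub>R v x) w\<bar> \<le> (LINT x|lebesgue_on D. norm ((c x *\<^sub>R v x) \<bullet> w x))"
    unfolding L2_inner_def using integral_norm_bound[of "lebesgue_on D" "\<lambda>x. (c x *\<^sub>R v x) \<bullet> w x"]
    by (simp only: real_norm_def)
  also have "\<dots> \<le> (LINT x|lebesgue_on D. ?g x)"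
    by (rule integral_mono_AE[OF _ ig AEb]) (rule integrable_norm[OF i])
  also have "\<dots> = B / 2 * ((L2_norm D v)\<^sup>2 + (L2_norm D w)\<^sup>2)"
    unfolding L2_normsq_eq using iv iw by simp
  finally show ?bnd by simp
qed

lemma L2_inner_integrable:
  assumes "v \<in> L2 D" "w \<in> L2 D"
  shows "integrable (lebesgue_on D) (\<lambda>x. v x \<bullet> w x)"
  using weighted_inner_bound(1)[OF assms, of "\<lambda>_. 1" 1] by simp

text \<open>The bound \<open>B\<close> serves to make the weighted integrand integrable and does not
  enter the estimate. The constants of the scheme thus stay independent of the size of the diffusion
  coefficients.\<close>

lemma coercive_weight:
  assumes v: "v \<in> L2 D" and D: "D \<in> sets lebesgue"
    and c: "c \<in> borel_measurable (lebesgue_on D)" "AE x in lebesgue_on D. \<bar>c x\<bar> \<le> B"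
    and ge: "\<And>x. x \<in> D \<Longrightarrow> \<theta> \<le> c x"
  shows "\<theta> * (L2_norm D v)\<^sup>2 \<le> L2_inner D (\<lambda>x. c x *\<^sub>R v x) v"
proof -
  have "\<theta> * (L2_norm D v)\<^sup>2 = (LINT x|lebesgue_on D. \<theta> * (v x \<bullet> v x))"
    by (simp add: L2_norm_squared L2_inner_def)
  also have "\<dots> \<le> L2_inner D (\<lambda>x. c x *\<^sub>R v x) v"
    unfolding L2_inner_def
  proof (rule integral_mono)
    show "integrable (lebesgue_on D) (\<lambda>x. \<theta> * (v x \<bullet> v x))"
      using L2_inner_integrable[OF v v] by simp
    show "integrable (lebesgue_on D) (\<lambda>x. (c x *\<^sub>R v x) \<bullet> v x)"
      by (rule weighted_inner_bound(1)[OF v v c])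
    show "\<theta> * (v x \<bullet> v x) \<le> (c x *\<^sub>R v x) \<bullet> v x" if "x \<in> space (lebesgue_on D)" for x
      using ge[of x] that by (auto intro!: mult_right_mono)
  qed
  finally show ?thesis .
qed

text \<open>The exact identity also contains the squared norm of \<open>v - w\<close>. This
  numerical dissipation is discarded by applying Young's inequality to the mixed product.\<close>

lemma backward_difference_inner:
  fixes v w :: "'a::euclidean_space \<Rightarrow> real"
  assumes v: "v \<in> L2 D" and w: "w \<in> L2 D" and dt: "dt > 0"
  shows "(L2_norm D v)\<^sup>2 - (L2_norm D w)\<^sup>2 \<le> 2 * dt * L2_inner D (\<lambda>x. (v x - w x) / dt) v"
proof -
  have i: "integrable (lebesgue_on D) (\<lambda>x. v x * v x)" "integrable (lebesgue_on D) (\<lambda>x. w x * v x)"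
    using L2_inner_integrable[OF v v] L2_inner_integrable[OF w v] by simp_all
  have "L2_inner D (\<lambda>x. (v x - w x) / dt) v
      = (LINT x|lebesgue_on D. (v x * v x - w x * v x) / dt)"
    unfolding L2_inner_def by (intro Bochner_Integration.integral_cong) (auto simp: algebra_simps diff_divide_distrib)
  also have "\<dots> = (L2_inner D v v - L2_inner D w v) / dt"
    using i by (simp add: L2_inner_def)
  finally have "2 * dt * L2_inner D (\<lambda>x. (v x - w x) / dt) v = 2 * L2_inner D v v - 2 * L2_inner D w v"
    using dt by simp
  moreover have "2 * \<bar>L2_inner D w v\<bar> \<le> (L2_norm D w)\<^sup>2 + (L2_norm D v)\<^sup>2"
    using weighted_inner_bound(2)[OF w v, of "\<lambda>_. 1" 1] by simp
  ultimately show ?thesis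
    unfolding L2_norm_squared[of D v] by linarith
qed

section \<open>Pointwise consequences of essential bounds\<close>

lemma Linf_norm_le_AE:
  assumes "v \<in> borel_measurable (lebesgue_on D)" "Linf_norm D v \<le> ereal B"
  shows "AE x in lebesgue_on D. norm (v x) \<le> B"
proof -
  have "AE x in lebesgue_on D. ereal (norm (v x)) \<le> esssup (lebesgue_on D) (\<lambda>x. ereal (norm (v x)))"
    by (rule esssup_AE)
  then show ?thesis
    by eventually_elim (use assms(2) in \<open>metis Linf_norm_def ereal_less_eq(3) order_trans\<close>)
qed

lemma Linf_bound_exists:
  assumes "v \<in> Linf D"
  obtains B where "AE x in lebesgue_on D. norm (v x) \<le> B"
proof -
  have "Linf_norm D v < \<infinity>" and m: "v \<in> borel_measurable (lebesgue_on D)"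
    using assms by (auto simp: Linf_def)
  then obtain B where "Linf_norm D v \<le> ereal B"
    by (cases "Linf_norm D v") auto
  from that[OF Linf_norm_le_AE[OF m this]] show ?thesis .
qed

section \<open>The dual norm\<close>

text \<open>The Sobolev space is defined through the components of the gradient. Measurability and
  square integrability of the whole gradient are reassembled from them by summing over the
  basis.\<close>

lemma sobolev_1_D:
  assumes "v \<in> sobolev_H 1 D"
  shows "v \<in> L2 D" "weakly_differentiable D v" "wgrad D v \<in> L2 D"
proof -
  have *: "v \<in> L2 D" "weakly_differentiable D v" "\<And>b. b \<in> Basis \<Longrightarrow> (\<lambda>x. wgrad D v x \<bullet> b) \<in> L2 D"
    using assms by auto
  then show "v \<in> L2 D" "weakly_differentiable D v" by auto
  have m: "wgrad D v \<in> borel_measurable (lebesgue_on D)"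
    using *(3) by (subst borel_measurable_euclidean_space) (auto simp: L2_def)
  have "integrable (lebesgue_on D) (\<lambda>x. \<Sum>b\<in>Basis. (wgrad D v x \<bullet> b)\<^sup>2)"
    using *(3) by (intro Bochner_Integration.integrable_sum) (auto simp: L2_def)
  moreover have "(norm (wgrad D v x))\<^sup>2 = (\<Sum>b\<in>Basis. (wgrad D v x \<bullet> b)\<^sup>2)" for x
    unfolding power2_norm_eq_inner by (subst euclidean_inner) (simp add: power2_eq_square)
  ultimately show "wgrad D v \<in> L2 D"
    using m by (simp add: L2_def)
qed

section \<open>Invariance of weak gradients and of \<open>H10\<close> under changes on null
  sets\<close>

lemma AE_lebesgue_on_subset:
  assumes "AE x in lebesgue_on D. P x" "K \<subseteq> D" "D \<in> sets lebesgue" "K \<in> sets lebesgue"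
  shows "AE x in lebesgue_on K. P x"
  using assms by (auto simp: AE_restrict_space_iff elim!: eventually_mono)

lemma locally_integrable_cong_AE:
  assumes "locally_integrable D v" "AE x in lebesgue_on D. v x = w x"
    and w: "w \<in> borel_measurable (lebesgue_on D)" and D: "D \<in> sets lebesgue"
  shows "locally_integrable D w"
  unfolding locally_integrable_def
proof safe
  fix K :: "'a set" assume K: "compact K" "K \<subseteq> D"
  then have KL: "K \<in> sets lebesgue" by (simp add: compact_imp_closed borel_closed)
  have iv: "integrable (lebesgue_on K) v" using assms(1) K by (auto simp: locally_integrable_def)
  have mw: "w \<in> borel_measurable (lebesgue_on K)"
    using w K(2) by (rule measurable_restrict_mono)
  have "AE x in lebesgue_on K. v x = w x"
    by (rule AE_lebesgue_on_subset[OF assms(2) K(2) D KL])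
  then show "integrable (lebesgue_on K) w"
    by (rule integrable_cong_AE_imp[OF iv mw])
qed

lemma has_weak_gradient_cong_AE_imp:
  assumes "has_weak_gradient D v g" "AE x in lebesgue_on D. v x = w x"
    and v: "v \<in> borel_measurable (lebesgue_on D)"
    and w: "w \<in> borel_measurable (lebesgue_on D)" and D: "D \<in> sets lebesgue"
  shows "has_weak_gradient D w g"
proof -
  have "(LINT x|lebesgue_on D. w x * frechet_derivative \<phi> (at x) b)
      = (LINT x|lebesgue_on D. v x * frechet_derivative \<phi> (at x) b)"
    if "test_function D \<phi>" "b \<in> Basis" for \<phi> b
  proof -
    \<comment> \<open>Comparing the integrals needs measurable integrands, so
      \<open>frechet_derivative\<close> is identified with the continuous gradient supplied by the
      first derivative.\<close>
    have "continuously_differentiable 1 \<phi>" using that(1) by (simp add: test_function_def)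
    then obtain g where g: "\<And>x. (\<phi> has_derivative (\<lambda>h. g x \<bullet> h)) (at x)"
      "\<And>b. b \<in> Basis \<Longrightarrow> continuous_on UNIV (\<lambda>x. g x \<bullet> b)" by auto
    have eq: "frechet_derivative \<phi> (at x) b = g x \<bullet> b" for x
      using frechet_derivative_at[OF g(1)[of x]] by metis
    have "(\<lambda>x. g x \<bullet> b) \<in> borel_measurable borel"
      by (rule borel_measurable_continuous_onI[OF g(2)[OF that(2)]])
    then have "(\<lambda>x. g x \<bullet> b) \<in> borel_measurable (lebesgue_on D)"
      by (intro measurable_restrict_space1) (simp add: measurable_completion)
    then have [measurable]: "(\<lambda>x. frechet_derivative \<phi> (at x) b) \<in> borel_measurable (lebesgue_on D)"
      unfolding eq .
    note [measurable] = v w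
    show ?thesis
      by (rule integral_cong_AE) (use assms(2) in \<open>auto elim!: eventually_mono\<close>)
  qed
  then show ?thesis
    using assms(1) locally_integrable_cong_AE[OF _ assms(2) w D]
    by (auto simp: has_weak_gradient_def)
qed

text \<open>Equality holds everywhere, not just almost everywhere: both functions have the same set
  of weak gradients, so the choice operator selects the same representative.\<close>

lemma wgrad_cong_AE:
  assumes "AE x in lebesgue_on D. v x = w x"
    and v: "v \<in> borel_measurable (lebesgue_on D)"
    and w: "w \<in> borel_measurable (lebesgue_on D)" and D: "D \<in> sets lebesgue"
  shows "wgrad D v = wgrad D w"
proof -
  have "AE x in lebesgue_on D. w x = v x"
    using assms(1) by eventually_elim simp
  then have "has_weak_gradient D v = has_weak_gradient D w"
    using has_weak_gradient_cong_AE_imp[OF _ assms(1) v w D]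
      has_weak_gradient_cong_AE_imp[OF _ _ w v D] by blast
  then show ?thesis by (simp add: wgrad_def)
qed

lemma test_function_measurable:
  assumes "test_function D \<phi>"
  shows "\<phi> \<in> borel_measurable (lebesgue_on D)"
proof -
  have "continuously_differentiable 0 \<phi>"
    using assms unfolding test_function_def by blast
  then have "\<phi> \<in> borel_measurable borel"
    by (intro borel_measurable_continuous_onI) simp
  then show ?thesis
    by (intro measurable_restrict_space1) (simp add: measurable_completion)
qed

text \<open>The same test functions approximate both functions, since the differences have identical
  chosen gradients and equal L2 norms. This puts every multiple of a null function of
  \<open>H10\<close> back into \<open>H10\<close>.\<close>

lemma H10_cong_AE:
  assumes v: "v \<in> H10 D" and ae: "AE x in lebesgue_on D. v x = w x"
    and w: "w \<in> borel_measurable (lebesgue_on D)" and D: "D \<in> sets lebesgue"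
  shows "w \<in> H10 D"
proof -
  have s: "v \<in> sobolev_H 1 D" using v by (simp add: H10_def)
  have mv: "v \<in> borel_measurable (lebesgue_on D)"
    and iv: "integrable (lebesgue_on D) (\<lambda>x. (norm (v x))\<^sup>2)"
    using sobolev_1_D(1)[OF s] by (auto simp: L2_def)
  have "integrable (lebesgue_on D) (\<lambda>x. (norm (w x))\<^sup>2)"
    using iv by (rule integrable_cong_AE_imp) (use w ae in \<open>auto elim!: eventually_mono\<close>)
  then have L: "w \<in> L2 D" using w by (simp add: L2_def)
  have wd: "weakly_differentiable D w"
    using sobolev_1_D(2)[OF s] has_weak_gradient_cong_AE_imp[OF _ ae mv w D]
    by (auto simp: weakly_differentiable_def)
  have "w \<in> sobolev_H 1 D"
    using s L wd wgrad_cong_AE[OF ae mv w D] by simp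
  moreover obtain \<phi> where \<phi>: "\<And>k. test_function D (\<phi> k)"
    "(\<lambda>k. H1_norm D (\<lambda>x. v x - \<phi> k x)) \<longlonglongrightarrow> 0"
    using v by (auto simp: H10_def)
  moreover have "H1_norm D (\<lambda>x. v x - \<phi> k x) = H1_norm D (\<lambda>x. w x - \<phi> k x)" for k
  proof -
    note [measurable] = mv w test_function_measurable[OF \<phi>(1)[of k]]
    have ae': "AE x in lebesgue_on D. v x - \<phi> k x = w x - \<phi> k x"
      using ae by eventually_elim simp
    have "wgrad D (\<lambda>x. v x - \<phi> k x) = wgrad D (\<lambda>x. w x - \<phi> k x)"
      by (rule wgrad_cong_AE[OF ae' _ _ D]) measurable
    moreover have "L2_norm D (\<lambda>x. v x - \<phi> k x) = L2_norm D (\<lambda>x. w x - \<phi> k x)"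
      unfolding L2_norm_def L2_inner_def
      by (rule arg_cong[where f=sqrt], rule integral_cong_AE) (use ae in \<open>auto elim!: eventually_mono\<close>)
    ultimately show ?thesis by (simp add: H1_norm_def)
  qed
  ultimately show ?thesis
    by (auto simp: H10_def)
qed

text \<open>
  Whether the representative \<open>wgrad D v\<close> of a null function \<open>v\<close> vanishes is immaterial: all multiples of
  \<open>v\<close> share it, so \<open>F\<close> is bounded on the line spanned by \<open>v\<close>.
\<close>

lemma Hm1_null:
  assumes F: "F \<in> Hm1 D" and v: "v \<in> H10 D" and D: "D \<in> sets lebesgue"
    and ae: "AE x in lebesgue_on D. v x = 0"
  shows "F v = 0"
proof (rule ccontr)
  assume n0: "F v \<noteq> 0"
  obtain B where B: "\<And>v. v \<in> H10 D \<Longrightarrow> \<bar>F v\<bar> \<le> B * L2_norm D (wgrad D v)"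
    using F unfolding Hm1_def by blast
  have mv: "v \<in> borel_measurable (lebesgue_on D)"
    using v sobolev_1_D(1)[of v D] by (auto simp: H10_def L2_def)
  have bound: "\<bar>c\<bar> * \<bar>F v\<bar> \<le> B * L2_norm D (wgrad D v)" for c
  proof -
    have ae': "AE x in lebesgue_on D. v x = c * v x"
      using ae by eventually_elim simp
    have m: "(\<lambda>x. c * v x) \<in> borel_measurable (lebesgue_on D)"
      using mv by measurable
    show ?thesis
      using B[OF H10_cong_AE[OF v ae' m D]] wgrad_cong_AE[OF ae' mv m D] F v
      by (simp add: Hm1_def abs_mult)
  qed
  show False
    \<comment> \<open>With this multiple the left side of the bound exceeds the right side by at
      least 1.\<close>
    using bound[of "(\<bar>B * L2_norm D (wgrad D v)\<bar> + 1) / \<bar>F v\<bar>"] n0 by simp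
qed

section \<open>The duality estimate in weighted form\<close>

lemma L2_norm_nonneg: "0 \<le> L2_norm D v"
  unfolding L2_norm_def L2_inner_def by (simp add: integral_nonneg_AE)

text \<open>The duality bound by \<open>Hm1_norm\<close> is combined with Young's inequality of
  weight \<open>\<delta>\<close>. As the right side is nonnegative, only a positive value
  \<open>F v\<close> requires the duality bound.\<close>

lemma Hm1_young:
  assumes F: "F \<in> Hm1 D" and v: "v \<in> H10 D" and D: "D \<in> sets lebesgue" and \<delta>: "\<delta> > 0"
  shows "2 * F v \<le> \<delta> * (L2_norm D (wgrad D v))\<^sup>2 + (Hm1_norm D F)\<^sup>2 / \<delta>"
proof -
  let ?g = "L2_norm D (wgrad D v)" and ?s = "Hm1_norm D F"
  obtain B where B: "\<And>v. v \<in> H10 D \<Longrightarrow> \<bar>F v\<bar> \<le> B * L2_norm D (wgrad D v)"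
    using F unfolding Hm1_def by blast
  \<comment> \<open>Positivity of \<open>F v\<close> excludes a vanishing gradient norm and a null
    function, so \<open>v\<close> belongs to the index set of the supremum.\<close>
  have le: "F v \<le> ?s * ?g" if nz: "F v > 0"
  proof -
    have g: "?g > 0"
      using B[OF v] nz L2_norm_nonneg[of D "wgrad D v"] by (cases "?g = 0") auto
    have "\<not> (AE x in lebesgue_on D. v x = 0)"
      using Hm1_null[OF F v D] nz by auto
    \<comment> \<open>A real supremum dominates its members only if they are bounded above. The
      absolute value covers a negative \<open>B\<close> and also the case of zero gradient norm,
      where the quotient is 0 by convention.\<close>
    moreover have "F w / L2_norm D (wgrad D w) \<le> \<bar>B\<bar>" if "w \<in> H10 D" for w
    proof (cases "L2_norm D (wgrad D w) = 0")
      case False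
      then have "L2_norm D (wgrad D w) > 0" using L2_norm_nonneg[of D "wgrad D w"] by simp
      moreover have "F w \<le> \<bar>B\<bar> * L2_norm D (wgrad D w)"
        using B[OF that] mult_right_mono[OF abs_ge_self[of B] L2_norm_nonneg[of D "wgrad D w"]]
        by linarith
      ultimately show ?thesis by (simp add: divide_le_eq)
    qed simp
    ultimately have "F v / ?g \<le> ?s"
      unfolding Hm1_norm_def using v by (intro cSUP_upper) (auto intro!: bdd_aboveI2)
    then show ?thesis using g by (simp add: divide_le_eq)
  qed
  have y: "2 * (?s * ?g) \<le> \<delta> * ?g\<^sup>2 + ?s\<^sup>2 / \<delta>"
  proof -
    have "0 \<le> (\<delta> * ?g - ?s)\<^sup>2 / \<delta>" using \<delta> by simp
    also have "\<dots> = \<delta> * ?g\<^sup>2 + ?s\<^sup>2 / \<delta> - 2 * (?s * ?g)"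
      using \<delta> by (simp add: field_simps power2_eq_square)
    finally show ?thesis by simp
  qed
  show ?thesis
  proof (cases "F v > 0")
    case True
    then show ?thesis using le y by linarith
  next
    case False
    moreover have "0 \<le> \<delta> * ?g\<^sup>2 + ?s\<^sup>2 / \<delta>" using \<delta> by simp
    ultimately show ?thesis by linarith
  qed
qed

section \<open>The energy estimate\<close>

text \<open>One time step in abstract form: \<open>v\<close> is the new and \<open>w\<close> the old
  level, \<open>m\<close> stands for the ensemble mean and \<open>c\<close> for the fluctuation of
  one member.\<close>

lemma energy_step:
  assumes D: "D \<in> sets lebesgue" and dt: "dt > 0" and \<theta>: "\<theta>p < \<theta>"
    and v: "v \<in> H10 D" and w: "w \<in> H10 D" and F: "F \<in> Hm1 D"
    and m: "m \<in> borel_measurable (lebesgue_on D)" "AE x in lebesgue_on D. \<bar>m x\<bar> \<le> B"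
      "\<And>x. x \<in> D \<Longrightarrow> \<theta> \<le> m x"
    and c: "c \<in> borel_measurable (lebesgue_on D)" "AE x in lebesgue_on D. \<bar>c x\<bar> \<le> \<theta>p"
    and eq: "L2_inner D (\<lambda>x. (v x - w x) / dt) v + L2_inner D (\<lambda>x. m x *\<^sub>R wgrad D v x) (wgrad D v)
       + L2_inner D (\<lambda>x. c x *\<^sub>R wgrad D w x) (wgrad D v) = F v"
  shows "(L2_norm D v)\<^sup>2 + \<theta> * dt * (L2_norm D (wgrad D v))\<^sup>2
     \<le> (L2_norm D w)\<^sup>2 + \<theta>p * dt * (L2_norm D (wgrad D w))\<^sup>2 + dt * ((Hm1_norm D F)\<^sup>2 / (\<theta> - \<theta>p))"
proof -
  have s: "v \<in> sobolev_H 1 D" "w \<in> sobolev_H 1 D"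
    using v w by (auto simp: H10_def)
  let ?G = "(L2_norm D (wgrad D v))\<^sup>2" and ?H = "(L2_norm D (wgrad D w))\<^sup>2"
  let ?X = "L2_inner D (\<lambda>x. (v x - w x) / dt) v"
  have 1: "(L2_norm D v)\<^sup>2 - (L2_norm D w)\<^sup>2 \<le> 2 * dt * ?X"
    by (rule backward_difference_inner[OF sobolev_1_D(1)[OF s(1)] sobolev_1_D(1)[OF s(2)] dt])
  have 2: "\<theta> * ?G \<le> L2_inner D (\<lambda>x. m x *\<^sub>R wgrad D v x) (wgrad D v)"
    by (rule coercive_weight[OF sobolev_1_D(3)[OF s(1)] D m])
  have 3: "2 * \<bar>L2_inner D (\<lambda>x. c x *\<^sub>R wgrad D w x) (wgrad D v)\<bar> \<le> \<theta>p * (?H + ?G)"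
    by (rule weighted_inner_bound(2)[OF sobolev_1_D(3)[OF s(2)] sobolev_1_D(3)[OF s(1)] c])
  have 4: "2 * F v \<le> (\<theta> - \<theta>p) * ?G + (Hm1_norm D F)\<^sup>2 / (\<theta> - \<theta>p)"
    by (rule Hm1_young[OF F v D]) (use \<theta> in simp)
  \<comment> \<open>Coercivity supplies \<open>2 * \<theta> * ?G\<close>. The lagged term consumes
    \<open>\<theta>p * ?G\<close> and the load \<open>(\<theta> - \<theta>p) * ?G\<close>, so
    exactly \<open>\<theta> * ?G\<close> survives.\<close>
  have "2 * ?X \<le> \<theta>p * ?H - \<theta> * ?G + (Hm1_norm D F)\<^sup>2 / (\<theta> - \<theta>p)"
    using 2 3 4 eq unfolding abs_le_iff by (simp add: algebra_simps)
  from mult_left_mono[OF this, of dt] dt 1 show ?thesis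
    by (simp add: algebra_simps)
qed

text \<open>Split \<theta> into \<open>\<theta>p\<close> and \<open>\<theta> - \<theta>p\<close>:
  the first share of each new gradient term cancels against the lagged term of the next step, the
  second accumulates in the sum.\<close>

lemma energy_telescope:
  fixes A G S :: "nat \<Rightarrow> real"
  assumes "\<And>n. n < N \<Longrightarrow> A (Suc n) + \<theta> * dt * G (Suc n) \<le> A n + \<theta>p * dt * G n + dt * S (Suc n)"
  shows "A N + \<theta>p * dt * G N + (\<theta> - \<theta>p) * dt * (\<Sum>n=1..N. G n) \<le> A 0 + \<theta>p * dt * G 0 + dt * (\<Sum>n=1..N. S n)"
  using assms
proof (induction N)
  case (Suc N)
  from Suc.IH Suc.prems have "A N + \<theta>p * dt * G N + (\<theta> - \<theta>p) * dt * (\<Sum>n=1..N. G n)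
      \<le> A 0 + \<theta>p * dt * G 0 + dt * (\<Sum>n=1..N. S n)" by simp
  with Suc.prems[of N] show ?case by (simp add: algebra_simps)
qed simp

lemma ensemble_mean_ge:
  assumes "J \<ge> 1" "\<And>j. j \<in> {1..J} \<Longrightarrow> \<theta> \<le> a j t x"
  shows "\<theta> \<le> ensemble_mean J a t x"
proof -
  have "real J * \<theta> \<le> (\<Sum>j=1..J. a j t x)"
    using sum_mono[of "{1..J}" "\<lambda>_. \<theta>" "\<lambda>j. a j t x"] assms(2) by simp
  then show ?thesis
    using assms(1) by (simp add: ensemble_mean_def field_simps)
qed

text \<open>The final gradient keeps the weight \<open>\<theta>p\<close> that telescoping produces,
  and the load keeps its explicit constant. Both are weakened to the form of the theorem
  afterwards.\<close>

lemma ensemble_stability: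
  assumes D: "D \<in> sets lebesgue" and \<theta>: "\<theta>p < \<theta>" and J: "J \<ge> 1" and dt: "dt > 0" and V: "V \<subseteq> H10 D"
    and af: "\<And>j n. j \<in> {1..J} \<Longrightarrow> n \<in> {1..N} \<Longrightarrow> a j (real n * dt) \<in> Linf D \<and> f j (real n * dt) \<in> Hm1 D"
    and ge: "\<And>j n x. j \<in> {1..J} \<Longrightarrow> n \<in> {1..N} \<Longrightarrow> x \<in> D \<Longrightarrow> \<theta> \<le> a j (real n * dt) x"
    and le: "\<And>j n. j \<in> {1..J} \<Longrightarrow> n \<in> {1..N} \<Longrightarrow>
       Linf_norm D (\<lambda>x. a j (real n * dt) x - ensemble_mean J a (real n * dt) x) \<le> ereal \<theta>p"
    and u: "ensemble_scheme D V dt N J a f u0 u" and j: "j \<in> {1..J}"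
  shows "(L2_norm D (u j N))\<^sup>2 + \<theta>p * dt * (L2_norm D (wgrad D (u j N)))\<^sup>2
       + (\<theta> - \<theta>p) * dt * (\<Sum>n=1..N. (L2_norm D (wgrad D (u j n)))\<^sup>2)
     \<le> (L2_norm D (u j 0))\<^sup>2 + \<theta>p * dt * (L2_norm D (wgrad D (u j 0)))\<^sup>2
       + dt * (\<Sum>n=1..N. (Hm1_norm D (f j (real n * dt)))\<^sup>2 / (\<theta> - \<theta>p))"
proof (rule energy_telescope)
  fix n assume n: "n < N"
  then have nN: "Suc n \<in> {1..N}" by simp
  let ?t = "real (Suc n) * dt"
  let ?m = "ensemble_mean J a ?t" and ?c = "\<lambda>x. a j ?t x - ensemble_mean J a ?t x"
  have uV: "u j (Suc n) \<in> V" "u j n \<in> V"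
    using u j n by (auto simp: ensemble_scheme_def)
  have ma: "a i ?t \<in> borel_measurable (lebesgue_on D)" if "i \<in> {1..J}" for i
    using af[OF that nN] by (simp add: Linf_def)
  have mm: "?m \<in> borel_measurable (lebesgue_on D)"
    unfolding ensemble_mean_def using ma
    by (intro borel_measurable_divide borel_measurable_sum) auto
  have mc: "?c \<in> borel_measurable (lebesgue_on D)"
    using ma[OF j] mm by measurable
  have c: "AE x in lebesgue_on D. \<bar>?c x\<bar> \<le> \<theta>p"
    using Linf_norm_le_AE[OF mc le[OF j nN]] by simp
  obtain B where B: "AE x in lebesgue_on D. \<bar>a j ?t x\<bar> \<le> B"
    using Linf_bound_exists[of "a j ?t" D] af[OF j nN] unfolding real_norm_def by blast
  \<comment> \<open>The mean is one member minus its fluctuation, so a bound on that single member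
    suffices.\<close>
  have m: "AE x in lebesgue_on D. \<bar>?m x\<bar> \<le> B + \<theta>p"
    using B c by eventually_elim linarith
  show "(L2_norm D (u j (Suc n)))\<^sup>2 + \<theta> * dt * (L2_norm D (wgrad D (u j (Suc n))))\<^sup>2
     \<le> (L2_norm D (u j n))\<^sup>2 + \<theta>p * dt * (L2_norm D (wgrad D (u j n)))\<^sup>2
       + dt * ((Hm1_norm D (f j ?t))\<^sup>2 / (\<theta> - \<theta>p))"
  proof (rule energy_step[OF D dt \<theta> _ _ _ mm m _ mc c])
    show "u j (Suc n) \<in> H10 D" "u j n \<in> H10 D" using uV V by auto
    show "f j ?t \<in> Hm1 D" using af[OF j nN] by simp
    show "\<theta> \<le> ?m x" if "x \<in> D" for x
      by (rule ensemble_mean_ge[where a=a, OF J]) (rule ge[OF _ nN that])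
    show "L2_inner D (\<lambda>x. (u j (Suc n) x - u j n x) / dt) (u j (Suc n))
        + L2_inner D (\<lambda>x. ?m x *\<^sub>R wgrad D (u j (Suc n)) x) (wgrad D (u j (Suc n)))
        + L2_inner D (\<lambda>x. ?c x *\<^sub>R wgrad D (u j n) x) (wgrad D (u j (Suc n))) = f j ?t (u j (Suc n))"
      using u j n uV unfolding ensemble_scheme_def Let_def by blast
  qed
qed

section \<open>Stability with a uniform constant\<close>

theorem theorem3p1:
  fixes \<theta> \<theta>m \<theta>p :: real
  assumes "\<theta> > 0" "\<theta>m > 0" "\<theta>p > 0" and "\<theta> > \<theta>p"
  shows "\<exists>C>0. \<forall>(D :: 'a::euclidean_space set) (T::real) (l::nat) (J::nat) (N::nat) (\<rho>::real) \<T>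
      (a :: nat \<Rightarrow> real \<Rightarrow> 'a \<Rightarrow> real) (f :: nat \<Rightarrow> real \<Rightarrow> ('a \<Rightarrow> real) \<Rightarrow> real)
      (u0 :: nat \<Rightarrow> 'a \<Rightarrow> real) (u :: nat \<Rightarrow> nat \<Rightarrow> 'a \<Rightarrow> real) (dt::real).
    DIM('a) \<in> {1, 2, 3} \<and> bounded D \<and> lipschitz_domain D \<and>
    T > 0 \<and> l \<ge> 1 \<and> J \<ge> 1 \<and> N \<ge> 1 \<and> dt = T / real N \<and>
    \<rho> > 0 \<and> quasi_uniform_triangulation \<rho> D \<T> \<and>
    (\<forall>j\<in>{1..J}. a j \<in> bochner_L2 T (W1inf D) (W1inf_norm D)) \<and>
    (\<forall>j\<in>{1..J}. f j \<in> bochner_L2 T (Hm1 D) (Hm1_norm D)) \<and>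
    (\<forall>j\<in>{1..J}. u0 j \<in> H10 D \<inter> sobolev_H (l + 1) D) \<and>
    (\<forall>j\<in>{1..J}. \<forall>n\<in>{1..N}. a j (real n * dt) \<in> Linf D \<and> f j (real n * dt) \<in> Hm1 D) \<and>
    (\<forall>t\<in>{0..T}. \<forall>j\<in>{1..J}. \<forall>x\<in>closure D. \<theta> \<le> a j t x) \<and>
    (\<forall>t\<in>{0..T}. \<forall>j\<in>{1..J}.
        ereal \<theta>m \<le> Linf_norm D (\<lambda>x. a j t x - ensemble_mean J a t x) \<and>
        Linf_norm D (\<lambda>x. a j t x - ensemble_mean J a t x) \<le> ereal \<theta>p) \<and>
    ensemble_scheme D (fe_space D \<T> l) dt N J a f u0 u
    \<longrightarrow>
    (\<forall>j\<in>{1..J}.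
       (L2_norm D (u j N))\<^sup>2 + \<theta>m * dt * (L2_norm D (wgrad D (u j N)))\<^sup>2
         + (\<theta> - \<theta>p) * dt * (\<Sum>n=1..N. (L2_norm D (wgrad D (u j n)))\<^sup>2)
       \<le> C * dt * (\<Sum>n=1..N. (Hm1_norm D (f j (real n * dt)))\<^sup>2)
         + C * dt * (L2_norm D (wgrad D (u j 0)))\<^sup>2 + (L2_norm D (u j 0))\<^sup>2)"
\<comment> \<open>The entry \<open>\<theta>p\<close> pays for the initial gradient, the reciprocal
  for the load after Young's inequality. The constant is fixed before the domain, the mesh, the
  ensemble and the time step.\<close>
proof (intro exI[of _ "max \<theta>p (1 / (\<theta> - \<theta>p))"] conjI allI impI ballI; (elim conjE)?)
  show "0 < max \<theta>p (1 / (\<theta> - \<theta>p))" using assms by simp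
next
  fix D :: "'a set" and T :: real and l J N :: nat and \<rho> :: real and \<T> :: "'a set set"
    and a :: "nat \<Rightarrow> real \<Rightarrow> 'a \<Rightarrow> real" and f :: "nat \<Rightarrow> real \<Rightarrow> ('a \<Rightarrow> real) \<Rightarrow> real"
    and u0 :: "nat \<Rightarrow> 'a \<Rightarrow> real" and u :: "nat \<Rightarrow> nat \<Rightarrow> 'a \<Rightarrow> real" and dt :: real and j :: nat
  assume j: "j \<in> {1..J}" and dom: "lipschitz_domain D" and T: "T > 0" and J: "J \<ge> 1" and N: "N \<ge> 1"
    and dt_eq: "dt = T / real N"
    and af: "\<forall>j\<in>{1..J}. \<forall>n\<in>{1..N}. a j (real n * dt) \<in> Linf D \<and> f j (real n * dt) \<in> Hm1 D"
    and ge: "\<forall>t\<in>{0..T}. \<forall>j\<in>{1..J}. \<forall>x\<in>closure D. \<theta> \<le> a j t x"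
    and le: "\<forall>t\<in>{0..T}. \<forall>j\<in>{1..J}.
        ereal \<theta>m \<le> Linf_norm D (\<lambda>x. a j t x - ensemble_mean J a t x) \<and>
        Linf_norm D (\<lambda>x. a j t x - ensemble_mean J a t x) \<le> ereal \<theta>p"
    and u: "ensemble_scheme D (fe_space D \<T> l) dt N J a f u0 u"
  let ?C = "max \<theta>p (1 / (\<theta> - \<theta>p))"
  let ?G = "\<lambda>n. (L2_norm D (wgrad D (u j n)))\<^sup>2" and ?S = "\<Sum>n=1..N. (Hm1_norm D (f j (real n * dt)))\<^sup>2"
  have dt: "dt > 0" using T N dt_eq by simp
  \<comment> \<open>The scheme evaluates coefficients and loads at levels 1 to \<open>N\<close>;
    these times must lie where the coefficient conditions are assumed.\<close>
  have time: "real n * dt \<in> {0..T}" if "n \<in> {1..N}" for n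
    using that T N by (auto simp: dt_eq field_simps)
  have "open D" using dom by (simp add: lipschitz_domain_def)
  then have D: "D \<in> sets lebesgue" by simp
  \<comment> \<open>Both constants enclose the fluctuation norm of member \<open>j\<close> at the
    final time. Hence the final gradient weight \<open>\<theta>p\<close> may be lowered to
    \<open>\<theta>m\<close>.\<close>
  have "ereal \<theta>m \<le> ereal \<theta>p"
    using le[rule_format, OF time[of N] j] N by (meson atLeastAtMost_iff le_refl order_trans)
  then have mp: "\<theta>m * dt * ?G N \<le> \<theta>p * dt * ?G N"
    using dt by (simp add: mult_right_mono)
  have main: "(L2_norm D (u j N))\<^sup>2 + \<theta>p * dt * ?G N + (\<theta> - \<theta>p) * dt * (\<Sum>n=1..N. ?G n)
     \<le> (L2_norm D (u j 0))\<^sup>2 + \<theta>p * dt * ?G 0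
       + dt * (\<Sum>n=1..N. (Hm1_norm D (f j (real n * dt)))\<^sup>2 / (\<theta> - \<theta>p))"
  proof (rule ensemble_stability[OF D \<open>\<theta>p < \<theta>\<close> J dt _ _ _ _ u j])
    show "fe_space D \<T> l \<subseteq> H10 D" by (auto simp: fe_space_def)
    show "\<theta> \<le> a i (real n * dt) x" if "i \<in> {1..J}" "n \<in> {1..N}" "x \<in> D" for i n x
      using ge time that closure_subset by blast
    show "Linf_norm D (\<lambda>x. a i (real n * dt) x - ensemble_mean J a (real n * dt) x) \<le> ereal \<theta>p"
      if "i \<in> {1..J}" "n \<in> {1..N}" for i n
      using le[rule_format, OF time[OF that(2)] that(1)] ..
  qed (rule af[rule_format])
  have "\<theta>p * dt * ?G 0 \<le> ?C * dt * ?G 0"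
    using dt by (intro mult_right_mono) auto
  moreover have "dt * (\<Sum>n=1..N. (Hm1_norm D (f j (real n * dt)))\<^sup>2 / (\<theta> - \<theta>p)) \<le> ?C * dt * ?S"
  proof -
    have "dt * (\<Sum>n=1..N. (Hm1_norm D (f j (real n * dt)))\<^sup>2 / (\<theta> - \<theta>p)) = 1 / (\<theta> - \<theta>p) * dt * ?S"
      by (simp flip: sum_divide_distrib)
    also have "\<dots> \<le> ?C * dt * ?S"
      using dt by (intro mult_right_mono sum_nonneg) auto
    finally show ?thesis .
  qed
  ultimately show "(L2_norm D (u j N))\<^sup>2 + \<theta>m * dt * ?G N + (\<theta> - \<theta>p) * dt * (\<Sum>n=1..N. ?G n)
       \<le> ?C * dt * ?S + ?C * dt * ?G 0 + (L2_norm D (u j 0))\<^sup>2"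
    using main mp by linarith
qed

end
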